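(* Let $\mathcal{N}$ be an $N=2$ superconformal algebra over $\mathbb{C}$ (in either the Ramond or the Neveu–Schwarz basis). Then there are no non-trivial transposed Poisson superalgebra structures defined on $\mathcal{N}$.
   Context: The $N=2$ superconformal algebra is the complex Lie superalgebra with basis of even elements $\{L_n,J_n\}_{n\in\mathbb{Z}}\cup\{c\}$ and odd elements $\{G_r^+,G_r^-\}_{r\in i+\mathbb{Z}}$, where $i=0$ (Ramond basis) or $i=\frac12$ (Neveu–Schwarz basis), $c$ is central, and $[L_m,L_n]=(m-n)L_{m+n}+\frac{c}{12}(m^3-m)\delta_{m+n,0}$, $[L_m,J_n]=-nJ_{m+n}$, $[J_m,J_n]=\frac c3m\,\delta_{m+n,0}$, $[J_m,G_r^{\pm}]=\pm G_{m+r}^{\pm}$, $[L_m,G_r^{\pm}]=\left(\frac m2-r\right)G_{r+m}^{\pm}$, $[G_r^+,G_s^-]=L_{r+s}+\frac12(r-s)J_{r+s}+\frac c6\left(r^2-\frac14\right)\delta_{r+s,0}$, $[G_r^+,G_s^+]=[G_r^-,G_s^-]=0$. A transposed Poisson superalgebra structure on a complex Lie superalgebra $(\mathfrak{L}=\mathfrak{L}_0\oplus\mathfrak{L}_1,[\;,\;])$ is a bilinear operation $\cdot$ on $\mathfrak{L}$, compatible with the $\mathbb{Z}_2$-grading, such that $(\mathfrak{L},\cdot)$ is a supercommutative associative superalgebra (not necessarily unital) and $2z\cdot[x,y]=[z\cdot x,y]+(-1)^{|x||z|}[x,z\cdot y]$ for all homogeneous $x,y,z$, where $|x|$ is the parity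 of $x$. The structure is non-trivial if both operations $\cdot$ and $[\;,\;]$ are not identically zero. *)

theory Defs
  imports Complex_Main "HOL-Library.Poly_Mapping" "HOL-Library.Z2"
begin

text \<open>
  Parities are elements of the field \<^typ>\<open>bit\<close> with two elements; a \<open>\<int>\<^sub>2\<close>-grading is a family
  \<open>V :: bit \<Rightarrow> 'a set\<close>, where \<open>V 0\<close> is the even part and \<open>V 1\<close> the odd part.
\<close>

definition koszul_sign :: "bit \<Rightarrow> bit \<Rightarrow> complex" where
  "koszul_sign p q = (if p = 1 \<and> q = 1 then - 1 else 1)"

locale complex_superspace = vector_space scale
  for scale :: "complex \<Rightarrow> 'a::ab_group_add \<Rightarrow> 'a" +
  fixes V :: "bit \<Rightarrow> 'a set"
  assumes subspace_part: "subspace (V p)"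
    and parts_inter: "V 0 \<inter> V 1 = {0}"
    and parts_span: "\<exists>y\<in>V 0. \<exists>z\<in>V 1. x = y + z"

locale complex_superalgebra = complex_superspace scale V
  for scale :: "complex \<Rightarrow> 'a::ab_group_add \<Rightarrow> 'a" and V :: "bit \<Rightarrow> 'a set" +
  fixes mult :: "'a \<Rightarrow> 'a \<Rightarrow> 'a"
  assumes linear_right: "Vector_Spaces.linear scale scale (\<lambda>y. mult x y)"
    and linear_left: "Vector_Spaces.linear scale scale (\<lambda>x. mult x y)"
    and mult_part: "x \<in> V p \<Longrightarrow> y \<in> V q \<Longrightarrow> mult x y \<in> V (p + q)"

locale complex_lie_superalgebra = complex_superalgebra scale V br
  for scale :: "complex \<Rightarrow> 'a::ab_group_add \<Rightarrow> 'a" and V :: "bit \<Rightarrow> 'a set"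
    and br :: "'a \<Rightarrow> 'a \<Rightarrow> 'a" +
  assumes super_antisym:
      "x \<in> V p \<Longrightarrow> y \<in> V q \<Longrightarrow> br x y = - scale (koszul_sign p q) (br y x)"
    and super_jacobi:
      "x \<in> V p \<Longrightarrow> y \<in> V q \<Longrightarrow> z \<in> V r \<Longrightarrow>
        br x (br y z) = br (br x y) z + scale (koszul_sign p q) (br y (br x z))"

locale transposed_poisson_superalgebra =
  complex_lie_superalgebra scale V br + dot: complex_superalgebra scale V dot
  for scale :: "complex \<Rightarrow> 'a::ab_group_add \<Rightarrow> 'a" and V :: "bit \<Rightarrow> 'a set"
    and br dot :: "'a \<Rightarrow> 'a \<Rightarrow> 'a" +
  assumes dot_assoc: "dot (dot x y) z = dot x (dot y z)"
    and dot_supercomm: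
      "x \<in> V p \<Longrightarrow> y \<in> V q \<Longrightarrow> dot x y = scale (koszul_sign p q) (dot y x)"
    and transposed_leibniz:
      "x \<in> V p \<Longrightarrow> y \<in> V q \<Longrightarrow> z \<in> V r \<Longrightarrow>
        scale 2 (dot z (br x y)) = br (dot z x) y + scale (koszul_sign p r) (br x (dot z y))"

definition nontrivial_structure :: "('a::zero \<Rightarrow> 'a \<Rightarrow> 'a) \<Rightarrow> ('a \<Rightarrow> 'a \<Rightarrow> 'a) \<Rightarrow> bool" where
  "nontrivial_structure br dot \<longleftrightarrow> (\<exists>x y. dot x y \<noteq> 0) \<and> (\<exists>x y. br x y \<noteq> 0)"


text \<open>Finitely supported functions \<open>'b \<Rightarrow>\<^sub>0 complex\<close> model the complex vector space with basis \<open>'b\<close>.\<close>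

definition pm_scale :: "complex \<Rightarrow> ('b \<Rightarrow>\<^sub>0 complex) \<Rightarrow> ('b \<Rightarrow>\<^sub>0 complex)" where
  "pm_scale a x = Poly_Mapping.map ((*) a) x"

definition bilinear_extension ::
    "('b \<Rightarrow> 'b \<Rightarrow> ('b \<Rightarrow>\<^sub>0 complex)) \<Rightarrow> ('b \<Rightarrow>\<^sub>0 complex) \<Rightarrow> ('b \<Rightarrow>\<^sub>0 complex) \<Rightarrow> ('b \<Rightarrow>\<^sub>0 complex)" where
  "bilinear_extension f x y =
     (\<Sum>a\<in>Poly_Mapping.keys x. \<Sum>b\<in>Poly_Mapping.keys y.
        pm_scale (Poly_Mapping.lookup x a * Poly_Mapping.lookup y b) (f a b))"

datatype n2_sector = Ramond | Neveu_Schwarz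

text \<open>
  The odd generators are indexed by integers in both sectors: \<open>Gp k\<close> and \<open>Gm k\<close> stand for
  \<open>G\<^sup>+\<close> and \<open>G\<^sup>-\<close> with index \<open>r = k + i\<close>, where \<open>i = 0\<close> or \<open>i = 1/2\<close> is the shift of the sector.
  The index \<open>r + s\<close> for \<open>r = k + i\<close>, \<open>s = l + i\<close> is then the integer \<open>k + l + 2i\<close>.
\<close>

datatype n2_basis = L int | J int | C | Gp int | Gm int

fun twice_shift :: "n2_sector \<Rightarrow> int" where
  "twice_shift Ramond = 0"
| "twice_shift Neveu_Schwarz = 1"

definition g_index :: "n2_sector \<Rightarrow> int \<Rightarrow> complex" where
  "g_index s k = of_int k + of_int (twice_shift s) / 2"

fun n2_parity :: "n2_basis \<Rightarrow> bit" where
  "n2_parity (Gp k) = 1"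
| "n2_parity (Gm k) = 1"
| "n2_parity b = 0"

definition n2_part :: "bit \<Rightarrow> (n2_basis \<Rightarrow>\<^sub>0 complex) set" where
  "n2_part p = {x. \<forall>b\<in>Poly_Mapping.keys x. n2_parity b = p}"

text \<open>
  The brackets of generators in the order not listed in the usual presentation
  (\<open>[J,L]\<close>, \<open>[G,J]\<close>, \<open>[G,L]\<close>, \<open>[G\<^sup>-,G\<^sup>+]\<close>) are those forced by super-antisymmetry.
\<close>

fun n2_basis_bracket :: "n2_sector \<Rightarrow> n2_basis \<Rightarrow> n2_basis \<Rightarrow> (n2_basis \<Rightarrow>\<^sub>0 complex)" where
  "n2_basis_bracket s (L m) (L n) =
     Poly_Mapping.single (L (m + n)) (of_int (m - n)) +
     Poly_Mapping.single C (if m + n = 0 then of_int (m ^ 3 - m) / 12 else 0)"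
| "n2_basis_bracket s (L m) (J n) = Poly_Mapping.single (J (m + n)) (- of_int n)"
| "n2_basis_bracket s (J n) (L m) = Poly_Mapping.single (J (m + n)) (of_int n)"
| "n2_basis_bracket s (J m) (J n) =
     Poly_Mapping.single C (if m + n = 0 then of_int m / 3 else 0)"
| "n2_basis_bracket s (J m) (Gp k) = Poly_Mapping.single (Gp (m + k)) 1"
| "n2_basis_bracket s (Gp k) (J m) = Poly_Mapping.single (Gp (m + k)) (- 1)"
| "n2_basis_bracket s (J m) (Gm k) = Poly_Mapping.single (Gm (m + k)) (- 1)"
| "n2_basis_bracket s (Gm k) (J m) = Poly_Mapping.single (Gm (m + k)) 1"
| "n2_basis_bracket s (L m) (Gp k) =
     Poly_Mapping.single (Gp (m + k)) (of_int m / 2 - g_index s k)"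
| "n2_basis_bracket s (Gp k) (L m) =
     Poly_Mapping.single (Gp (m + k)) (- (of_int m / 2 - g_index s k))"
| "n2_basis_bracket s (L m) (Gm k) =
     Poly_Mapping.single (Gm (m + k)) (of_int m / 2 - g_index s k)"
| "n2_basis_bracket s (Gm k) (L m) =
     Poly_Mapping.single (Gm (m + k)) (- (of_int m / 2 - g_index s k))"
| "n2_basis_bracket s (Gp k) (Gm l) =
     Poly_Mapping.single (L (k + l + twice_shift s)) 1 +
     Poly_Mapping.single (J (k + l + twice_shift s)) ((g_index s k - g_index s l) / 2) +
     Poly_Mapping.single C
       (if k + l + twice_shift s = 0 then ((g_index s k)\<^sup>2 - 1 / 4) / 6 else 0)"
| "n2_basis_bracket s (Gm l) (Gp k) =
     Poly_Mapping.single (L (k + l + twice_shift s)) 1 +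
     Poly_Mapping.single (J (k + l + twice_shift s)) ((g_index s k - g_index s l) / 2) +
     Poly_Mapping.single C
       (if k + l + twice_shift s = 0 then ((g_index s k)\<^sup>2 - 1 / 4) / 6 else 0)"
| "n2_basis_bracket s (Gp k) (Gp l) = 0"
| "n2_basis_bracket s (Gm k) (Gm l) = 0"
| "n2_basis_bracket s C b = 0"
| "n2_basis_bracket s b C = 0"

definition n2_bracket ::
    "n2_sector \<Rightarrow> (n2_basis \<Rightarrow>\<^sub>0 complex) \<Rightarrow> (n2_basis \<Rightarrow>\<^sub>0 complex) \<Rightarrow> (n2_basis \<Rightarrow>\<^sub>0 complex)" where
  "n2_bracket s = bilinear_extension (n2_basis_bracket s)"


lemma lookup_pm_scale [simp]: "Poly_Mapping.lookup (pm_scale a x) b = a * Poly_Mapping.lookup x b"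
  by (simp add: pm_scale_def Poly_Mapping.map.rep_eq when_def)

lemma pm_scale_single [simp]:
  "pm_scale a (Poly_Mapping.single b c) = Poly_Mapping.single b (a * c)"
  by (simp add: pm_scale_def)

lemma vector_space_pm_scale: "vector_space pm_scale"
  by unfold_locales (auto intro!: poly_mapping_eqI simp: lookup_add algebra_simps)

interpretation pm: vector_space pm_scale
  by (rule vector_space_pm_scale)

lemma bilinear_extension_superset:
  assumes "finite A" "finite B" "Poly_Mapping.keys x \<subseteq> A" "Poly_Mapping.keys y \<subseteq> B"
  shows "bilinear_extension f x y =
    (\<Sum>a\<in>A. \<Sum>b\<in>B. pm_scale (Poly_Mapping.lookup x a * Poly_Mapping.lookup y b) (f a b))"
proof -
  have "(\<Sum>b\<in>Poly_Mapping.keys y. pm_scale (Poly_Mapping.lookup x a * Poly_Mapping.lookup y b) (f a b))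
      = (\<Sum>b\<in>B. pm_scale (Poly_Mapping.lookup x a * Poly_Mapping.lookup y b) (f a b))" for a
    using assms by (intro sum.mono_neutral_left) (auto simp: in_keys_iff)
  then show ?thesis
    unfolding bilinear_extension_def using assms
    by (auto intro!: sum.mono_neutral_left simp: in_keys_iff)
qed

lemma bilinear_extension_add_left:
  "bilinear_extension f (x + x') y = bilinear_extension f x y + bilinear_extension f x' y"
proof -
  let ?A = "Poly_Mapping.keys x \<union> Poly_Mapping.keys x'"
  have "Poly_Mapping.keys (x + x') \<subseteq> ?A" by (rule keys_add)
  then show ?thesis
    by (simp add: bilinear_extension_superset[of ?A "Poly_Mapping.keys y"] lookup_add
        distrib_right pm.scale_left_distrib sum.distrib)
qed

lemma bilinear_extension_add_right:
  "bilinear_extension f x (y + y') = bilinear_extension f x y + bilinear_extension f x y'"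
proof -
  let ?B = "Poly_Mapping.keys y \<union> Poly_Mapping.keys y'"
  have "Poly_Mapping.keys (y + y') \<subseteq> ?B" by (rule keys_add)
  then show ?thesis
    by (simp add: bilinear_extension_superset[of "Poly_Mapping.keys x" ?B] lookup_add
        distrib_left pm.scale_left_distrib sum.distrib)
qed

lemma keys_pm_scale: "Poly_Mapping.keys (pm_scale a x) \<subseteq> Poly_Mapping.keys x"
  by (auto simp: in_keys_iff)

lemma bilinear_extension_scale_left:
  "bilinear_extension f (pm_scale a x) y = pm_scale a (bilinear_extension f x y)"
  by (simp add: bilinear_extension_superset[of "Poly_Mapping.keys x" "Poly_Mapping.keys y"]
      keys_pm_scale pm.scale_sum_right mult.assoc)

lemma bilinear_extension_scale_right:
  "bilinear_extension f x (pm_scale a y) = pm_scale a (bilinear_extension f x y)"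
  by (simp add: bilinear_extension_superset[of "Poly_Mapping.keys x" "Poly_Mapping.keys y"]
      keys_pm_scale pm.scale_sum_right mult_ac)

lemma bilinear_extension_single:
  "bilinear_extension f (Poly_Mapping.single a u) (Poly_Mapping.single b v) = pm_scale (u * v) (f a b)"
  by (simp add: bilinear_extension_superset[of "{a}" "{b}"])

lemma bilinear_extension_zero [simp]:
  "bilinear_extension f 0 y = 0" "bilinear_extension f x 0 = 0"
  by (simp_all add: bilinear_extension_def)

lemma linear_bilinear_extension:
  "Vector_Spaces.linear pm_scale pm_scale (\<lambda>y. bilinear_extension f x y)"
  "Vector_Spaces.linear pm_scale pm_scale (\<lambda>x. bilinear_extension f x y)"
  by unfold_locales
    (simp_all add: bilinear_extension_add_left bilinear_extension_add_right
      bilinear_extension_scale_left bilinear_extension_scale_right)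

lemma subspace_n2_part: "pm.subspace (n2_part p)"
  unfolding n2_part_def
  by (rule pm.subspaceI) (use keys_add keys_pm_scale in fastforce)+

lemma n2_part_induct [consumes 1, case_names zero add single]:
  assumes "x \<in> n2_part p" "P 0" "\<And>x y. P x \<Longrightarrow> P y \<Longrightarrow> P (x + y)"
    and "\<And>b. n2_parity b = p \<Longrightarrow> (\<And>a. P (Poly_Mapping.single b a))"
  shows "P x"
proof -
  have P_sum: "P (\<Sum>b\<in>A. Poly_Mapping.single b (Poly_Mapping.lookup x b))"
    if "finite A" "A \<subseteq> Poly_Mapping.keys x" for A
    using that assms by (induction rule: finite_induct) (auto simp: n2_part_def)
  have "x = (\<Sum>b\<in>Poly_Mapping.keys x. Poly_Mapping.single b (Poly_Mapping.lookup x b))"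
    by (rule poly_mapping_eqI)
      (auto simp: lookup_sum lookup_single when_def in_keys_iff)
  with P_sum[of "Poly_Mapping.keys x"] show ?thesis by simp
qed

lemma single_in_n2_part [simp]:
  "Poly_Mapping.single b a \<in> n2_part p \<longleftrightarrow> a = 0 \<or> n2_parity b = p"
  by (auto simp: n2_part_def)

lemma n2_parts_span: "\<exists>y\<in>n2_part 0. \<exists>z\<in>n2_part 1. x = y + z"
proof -
  have "finite {b. (if n2_parity b = p then Poly_Mapping.lookup x b else 0) \<noteq> 0}" for p
    by (rule finite_subset[OF _ finite_keys[of x]]) (auto simp: in_keys_iff)
  then have look: "Poly_Mapping.lookup (Abs_poly_mapping
      (\<lambda>b. if n2_parity b = p then Poly_Mapping.lookup x b else 0)) =
      (\<lambda>b. if n2_parity b = p then Poly_Mapping.lookup x b else 0)" for p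
    by (rule lookup_Abs_poly_mapping)
  show ?thesis
    by (rule bexI[of _ "Abs_poly_mapping (\<lambda>b. if n2_parity b = 0 then Poly_Mapping.lookup x b else 0)"],
        rule bexI[of _ "Abs_poly_mapping (\<lambda>b. if n2_parity b = 1 then Poly_Mapping.lookup x b else 0)"])
      (auto intro!: poly_mapping_eqI simp: lookup_add look n2_part_def in_keys_iff split: if_splits)
qed

lemma n2_bracket_part:
  assumes "x \<in> n2_part p" "y \<in> n2_part q"
  shows "n2_bracket s x y \<in> n2_part (p + q)"
  using assms(1)
proof (induction rule: n2_part_induct)
  case (single a u)
  show ?case using assms(2)
  proof (induction rule: n2_part_induct)
    case (single b v)
    have "n2_basis_bracket s a b \<in> n2_part (p + q)"
      using \<open>n2_parity a = p\<close> \<open>n2_parity b = q\<close>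
      by (cases a; cases b) (auto intro!: pm.subspace_add[OF subspace_n2_part] pm.subspace_0[OF subspace_n2_part])
    then show ?case
      by (simp add: n2_bracket_def bilinear_extension_single pm.subspace_scale[OF subspace_n2_part])
  qed (simp_all add: n2_bracket_def bilinear_extension_add_right pm.subspace_0[OF subspace_n2_part]
      pm.subspace_add[OF subspace_n2_part])
qed (simp_all add: n2_bracket_def bilinear_extension_add_left pm.subspace_0[OF subspace_n2_part]
      pm.subspace_add[OF subspace_n2_part])

lemma n2_bracket_antisym:
  assumes "x \<in> n2_part p" "y \<in> n2_part q"
  shows "n2_bracket s x y = - pm_scale (koszul_sign p q) (n2_bracket s y x)"
  using assms(1)
proof (induction rule: n2_part_induct)
  case (single a u)
  show ?case using assms(2)
  proof (induction rule: n2_part_induct)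
    case (single b v)
    have "n2_basis_bracket s a b = - pm_scale (koszul_sign p q) (n2_basis_bracket s b a)"
      using \<open>n2_parity a = p\<close> \<open>n2_parity b = q\<close>
      by (cases a; cases b)
        (auto intro!: poly_mapping_eqI simp: koszul_sign_def lookup_add lookup_single when_def
          add_ac field_simps add_eq_0_iff power3_eq_cube)
    then show ?case
      by (simp add: n2_bracket_def bilinear_extension_single mult_ac)
  qed (simp_all add: n2_bracket_def bilinear_extension_add_right bilinear_extension_add_left
      pm.scale_right_distrib)
qed (simp_all add: n2_bracket_def bilinear_extension_add_left bilinear_extension_add_right
      pm.scale_right_distrib)

lemma n2_bracket_jacobi_basis:
  fixes s and a b d :: n2_basis
  defines "B \<equiv> bilinear_extension (n2_basis_bracket s)"
  defines "e \<equiv> \<lambda>b. Poly_Mapping.single b (1::complex)"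
  shows "B (e a) (B (e b) (e d)) = B (B (e a) (e b)) (e d) +
    pm_scale (koszul_sign (n2_parity a) (n2_parity b)) (B (e b) (B (e a) (e d)))"
  unfolding B_def e_def
  apply (rule poly_mapping_eqI)
  apply (cases a; cases b; cases d; simp add: koszul_sign_def bilinear_extension_single bilinear_extension_add_left
      bilinear_extension_add_right pm.scale_right_distrib lookup_add lookup_single when_def add_ac split del: if_split;
      ((auto simp: g_index_def power2_eq_square power3_eq_cube field_simps add_eq_0_iff)[1]; fail)?)
  apply (auto simp: eq_neg_iff_add_eq_0[symmetric] g_index_def power2_eq_square power3_eq_cube)
  apply (simp_all add: field_simps)
  done

lemma n2_bracket_jacobi:
  assumes "x \<in> n2_part p" "y \<in> n2_part q" "z \<in> n2_part r"
  shows "n2_bracket s x (n2_bracket s y z) = n2_bracket s (n2_bracket s x y) z +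
    pm_scale (koszul_sign p q) (n2_bracket s y (n2_bracket s x z))"
  using assms(1)
proof (induction rule: n2_part_induct)
  case (single a u)
  show ?case using assms(2)
  proof (induction rule: n2_part_induct)
    case (single b v)
    show ?case using assms(3)
    proof (induction rule: n2_part_induct)
      case (single d w)
      have "Poly_Mapping.single c t = pm_scale t (Poly_Mapping.single c 1)"
        for c :: n2_basis and t by simp
      then have e: "Poly_Mapping.single a u = pm_scale u (Poly_Mapping.single a 1)"
        "Poly_Mapping.single b v = pm_scale v (Poly_Mapping.single b 1)"
        "Poly_Mapping.single d w = pm_scale w (Poly_Mapping.single d 1)"
        by blast+
      show ?case
        unfolding e n2_bracket_def bilinear_extension_scale_left bilinear_extension_scale_right
          n2_bracket_jacobi_basis[of s a b d]
        using \<open>n2_parity a = p\<close> \<open>n2_parity b = q\<close>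
        by (simp add: pm.scale_right_distrib mult_ac)
    qed (simp_all add: n2_bracket_def bilinear_extension_add_right pm.scale_right_distrib)
  qed (simp_all add: n2_bracket_def bilinear_extension_add_right bilinear_extension_add_left
      pm.scale_right_distrib)
qed (simp_all add: n2_bracket_def bilinear_extension_add_left bilinear_extension_add_right
      pm.scale_right_distrib)

theorem n2_lie_superalgebra: "complex_lie_superalgebra pm_scale n2_part (n2_bracket s)"
proof (intro complex_lie_superalgebra.intro complex_superalgebra.intro complex_superspace.intro
    complex_lie_superalgebra_axioms.intro complex_superalgebra_axioms.intro
    complex_superspace_axioms.intro)
  show "vector_space pm_scale" by (rule vector_space_pm_scale)
  show "n2_part 0 \<inter> n2_part 1 = {0}"
    by (auto simp: n2_part_def simp flip: keys_eq_empty)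
  fix p q r x y z
  show "module.subspace pm_scale (n2_part p)" by (rule subspace_n2_part)
  show "\<exists>y\<in>n2_part 0. \<exists>z\<in>n2_part 1. x = y + z" by (rule n2_parts_span)
  show "Vector_Spaces.linear pm_scale pm_scale (n2_bracket s x)"
    "Vector_Spaces.linear pm_scale pm_scale (\<lambda>x. n2_bracket s x y)"
    unfolding n2_bracket_def by (rule linear_bilinear_extension)+
  assume "x \<in> n2_part p" "y \<in> n2_part q"
  then show "n2_bracket s x y \<in> n2_part (p + q)"
    "n2_bracket s x y = - pm_scale (koszul_sign p q) (n2_bracket s y x)"
    by (fact n2_bracket_part n2_bracket_antisym)+
  assume "z \<in> n2_part r"
  with \<open>x \<in> n2_part p\<close> \<open>y \<in> n2_part q\<close>
  show "n2_bracket s x (n2_bracket s y z) = n2_bracket s (n2_bracket s x y) z +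
    pm_scale (koszul_sign p q) (n2_bracket s y (n2_bracket s x z))"
    by (rule n2_bracket_jacobi)
qed

end

theory Submission
  imports Defs
begin

text \<open>
  The grading element \<open>J\<^sub>0\<close> does the work. Its adjoint map \<open>T\<close> vanishes on the even part and is an
  involution on the odd part, with eigenvalues \<open>\<plusminus>1\<close> on \<open>G\<^sup>\<plusminus>\<close>. Fix an odd \<open>z\<close>. The transposed
  Leibniz rule for a bracket with \<open>J\<^sub>0\<close> shows that the product \<open>z \<cdot> x\<close> is governed by the single
  odd vector \<open>u = z \<cdot> J\<^sub>0\<close>: it gives \<open>2 (z \<cdot> x) = [u, T x]\<close> for odd \<open>x\<close>, and for even \<open>x\<close> it
  gives \<open>T (z \<cdot> x) = - [u, x]\<close>. In particular \<open>v = z \<cdot> J\<^sub>1\<close> is \<open>u\<close> with all indices raised by one.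

  Inserting this into the rule for \<open>[J\<^sub>1, x]\<close> with \<open>x\<close> odd yields
  \<open>[u, T [J\<^sub>1, x]] = 2 [v, x] + [T v, T x]\<close>. For \<open>x = G\<^sub>r\<^sup>\<plusminus>\<close> the map \<open>x \<mapsto> T [J\<^sub>1, x]\<close> is the
  index shift and \<open>[T v, T x] = - [v, x]\<close>, because \<open>[G\<^sup>+, G\<^sup>+]\<close> and \<open>[G\<^sup>-, G\<^sup>-]\<close> vanish. So the
  identity says that the bracket is unchanged when one index is moved from \<open>x\<close> to \<open>u\<close>. But the
  \<open>J\<close>-part \<open>(r - s) / 2\<close> of \<open>[G\<^sub>r\<^sup>+, G\<^sub>s\<^sup>-]\<close> sees the difference of the indices, which such a move
  changes by two. This forces \<open>u = 0\<close> (\<open>odd_dot_J0\<close>), and hence odd elements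
  multiply everything to zero (\<open>odd_dot\<close>).

  By supercommutativity an even \<open>z\<close> now annihilates the odd part, so by the transposed Leibniz
  rule it annihilates all brackets of odd elements. These span the even part
  (\<open>even_part_spanned_by_odd_brackets\<close>), so the product is zero.
\<close>

section \<open>The adjoint action of the current modes\<close>

abbreviation gen :: "n2_basis \<Rightarrow> (n2_basis \<Rightarrow>\<^sub>0 complex)" where
  "gen b \<equiv> Poly_Mapping.single b 1"

lemma n2_bracket_add:
  "n2_bracket s (x + x') y = n2_bracket s x y + n2_bracket s x' y"
  "n2_bracket s x (y + y') = n2_bracket s x y + n2_bracket s x y'"
  by (simp_all add: n2_bracket_def bilinear_extension_add_left bilinear_extension_add_right)

lemma n2_bracket_scale:
  "n2_bracket s (pm_scale a x) y = pm_scale a (n2_bracket s x y)"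
  "n2_bracket s x (pm_scale a y) = pm_scale a (n2_bracket s x y)"
  by (simp_all add: n2_bracket_def bilinear_extension_scale_left bilinear_extension_scale_right)

lemma n2_bracket_zero [simp]: "n2_bracket s 0 y = 0" "n2_bracket s x 0 = 0"
  by (simp_all add: n2_bracket_def)

lemma n2_bracket_single:
  "n2_bracket s (Poly_Mapping.single a u) (Poly_Mapping.single b v) =
     pm_scale (u * v) (n2_basis_bracket s a b)"
  by (simp add: n2_bracket_def bilinear_extension_single)

lemma J0_bracket_even:
  assumes "w \<in> n2_part 0"
  shows "n2_bracket s (gen (J 0)) w = 0"
  using assms
proof (induction rule: n2_part_induct)
  case (single b a)
  then show ?case by (cases b) (simp_all add: n2_bracket_single)
qed (simp_all add: n2_bracket_add)

lemma lookup_J_bracket_odd: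
  assumes "w \<in> n2_part 1"
  shows "Poly_Mapping.lookup (n2_bracket s (gen (J m)) w) (Gp n) = Poly_Mapping.lookup w (Gp (n - m))"
    and "Poly_Mapping.lookup (n2_bracket s (gen (J m)) w) (Gm n) = - Poly_Mapping.lookup w (Gm (n - m))"
proof -
  have "Poly_Mapping.lookup (n2_bracket s (gen (J m)) w) (Gp n) = Poly_Mapping.lookup w (Gp (n - m)) \<and>
    Poly_Mapping.lookup (n2_bracket s (gen (J m)) w) (Gm n) = - Poly_Mapping.lookup w (Gm (n - m))"
    using assms
  proof (induction rule: n2_part_induct)
    case (single b a)
    then show ?case
      by (cases b) (auto simp: n2_bracket_single lookup_single when_def)
  qed (simp_all add: n2_bracket_add lookup_add)
  then show "Poly_Mapping.lookup (n2_bracket s (gen (J m)) w) (Gp n) = Poly_Mapping.lookup w (Gp (n - m))"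
    and "Poly_Mapping.lookup (n2_bracket s (gen (J m)) w) (Gm n) = - Poly_Mapping.lookup w (Gm (n - m))"
    by blast+
qed

lemma odd_eqI:
  assumes "x \<in> n2_part 1" "y \<in> n2_part 1"
    and "\<And>n. Poly_Mapping.lookup x (Gp n) = Poly_Mapping.lookup y (Gp n)"
    and "\<And>n. Poly_Mapping.lookup x (Gm n) = Poly_Mapping.lookup y (Gm n)"
  shows "x = y"
proof (rule poly_mapping_eqI)
  fix b
  show "Poly_Mapping.lookup x b = Poly_Mapping.lookup y b"
  proof (cases "n2_parity b = 1")
    case True
    then show ?thesis using assms(3,4) by (cases b) auto
  next
    case False
    then show ?thesis using assms(1,2) by (metis (mono_tags) n2_part_def in_keys_iff mem_Collect_eq)
  qed
qed

lemma J_bracket_odd_part: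
  assumes "w \<in> n2_part 1"
  shows "n2_bracket s (gen (J m)) w \<in> n2_part 1"
  using n2_bracket_part[of "gen (J m)" 0 w 1 s] assms by simp

lemma J0_bracket_involution:
  assumes "w \<in> n2_part 1"
  shows "n2_bracket s (gen (J 0)) (n2_bracket s (gen (J 0)) w) = w"
  by (rule odd_eqI) (simp_all add: assms J_bracket_odd_part lookup_J_bracket_odd)

section \<open>Brackets of odd elements\<close>

text \<open>
  Bracketing with one fixed \<open>G\<^sup>\<plusminus>\<close> sends different generators \<open>G\<^sup>\<mp>\<close> to different \<open>J\<^sub>n\<close>, so that each
  \<open>J\<close>-coefficient sees a single coefficient of \<open>w\<close>. The factor vanishes where the two indices
  agree, and there the \<open>J\<close>-coefficient alone carries no information.
\<close>

lemma lookup_odd_bracket_G: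
  assumes "w \<in> n2_part 1"
  shows "Poly_Mapping.lookup (n2_bracket s w (gen (Gp l))) (J (j + l + twice_shift s)) =
      Poly_Mapping.lookup w (Gm j) * of_int (l - j) / 2"
    and "Poly_Mapping.lookup (n2_bracket s w (gen (Gm l))) (J (j + l + twice_shift s)) =
      Poly_Mapping.lookup w (Gp j) * of_int (j - l) / 2"
proof -
  have "Poly_Mapping.lookup (n2_bracket s w (gen (Gp l))) (J (j + l + twice_shift s)) =
      Poly_Mapping.lookup w (Gm j) * of_int (l - j) / 2 \<and>
    Poly_Mapping.lookup (n2_bracket s w (gen (Gm l))) (J (j + l + twice_shift s)) =
      Poly_Mapping.lookup w (Gp j) * of_int (j - l) / 2"
    using assms
  proof (induction rule: n2_part_induct)
    case (single b a)
    then show ?case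
      by (cases b) (auto simp: n2_bracket_single lookup_single lookup_add when_def g_index_def)
  next
    case (add x y)
    then show ?case
      by (simp only: n2_bracket_add lookup_add distrib_right add_divide_distrib simp_thms)
  qed simp
  then show "Poly_Mapping.lookup (n2_bracket s w (gen (Gp l))) (J (j + l + twice_shift s)) =
      Poly_Mapping.lookup w (Gm j) * of_int (l - j) / 2"
    and "Poly_Mapping.lookup (n2_bracket s w (gen (Gm l))) (J (j + l + twice_shift s)) =
      Poly_Mapping.lookup w (Gp j) * of_int (j - l) / 2"
    by blast+
qed

text \<open>
  Among the brackets \<open>[G\<^sub>r\<^sup>+, G\<^sub>s\<^sup>-]\<close> with \<open>r + s = n\<close> fixed, the coefficient of \<open>J\<^sub>n\<close> is
  affine in \<open>r\<close> and the central one is quadratic. A second difference in \<open>r\<close> therefore isolates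
  \<open>c\<close>, then a first difference isolates \<open>J\<^sub>n\<close>, and \<open>L\<^sub>n\<close> is what remains.
\<close>

lemma even_part_spanned_by_odd_brackets:
  "n2_part 0 \<subseteq> pm.span {n2_bracket s x y | x y. x \<in> n2_part 1 \<and> y \<in> n2_part 1}"
    (is "_ \<subseteq> pm.span ?B")
proof -
  define b where "b n k = n2_bracket s (gen (Gp k)) (gen (Gm (n - k - twice_shift s)))" for n k
  have b_span: "b n k \<in> pm.span ?B" for n k
    unfolding b_def by (rule pm.span_base) (auto intro!: exI)
  define h where "h n k = (if n = 0 then ((g_index s k)\<^sup>2 - 1 / 4) / 6 else 0)" for n k :: int
  have b_eq: "b n k = gen (L n) +
      Poly_Mapping.single (J n) (of_int k + of_int (twice_shift s - n) / 2) +
      Poly_Mapping.single C (h n k)" for n k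
    by (simp add: b_def h_def n2_bracket_single g_index_def add_divide_distrib diff_divide_distrib)
  have C_eq: "gen C = pm_scale 3 (b 0 1 - b 0 0 - (b 0 0 - b 0 (- 1)))"
    unfolding b_eq
    by (rule poly_mapping_eqI)
      (auto simp: lookup_single lookup_add lookup_minus when_def
        h_def g_index_def power2_eq_square field_simps)
  have C: "gen C \<in> pm.span ?B"
    unfolding C_eq by (intro pm.span_scale pm.span_diff b_span)
  have J_eq: "gen (J n) = b n 1 - b n 0 - pm_scale (h n 1 - h n 0) (gen C)" for n
    unfolding b_eq
    by (rule poly_mapping_eqI) (simp add: lookup_single lookup_add lookup_minus when_def)
  have J: "gen (J n) \<in> pm.span ?B" for n
    unfolding J_eq by (intro pm.span_scale pm.span_diff b_span C)
  have L_eq: "gen (L n) = b n 0 - pm_scale (of_int (twice_shift s - n) / 2) (gen (J n))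
      - pm_scale (h n 0) (gen C)" for n
    unfolding b_eq by simp
  have L: "gen (L n) \<in> pm.span ?B" for n
    unfolding L_eq by (intro pm.span_scale pm.span_diff b_span C J)
  show ?thesis
  proof
    fix x assume "x \<in> n2_part 0"
    then show "x \<in> pm.span ?B"
    proof (induction rule: n2_part_induct)
      case (single d a)
      have "gen d \<in> pm.span ?B"
        using single C J L by (cases d) auto
      from pm.span_scale[OF this, of a] show ?case by simp
    next
      case (add x y)
      then show ?case by (rule pm.span_add)
    qed (rule pm.span_zero)
  qed
qed

section \<open>Vanishing of the product\<close>

locale n2_transposed_poisson =
  transposed_poisson_superalgebra pm_scale n2_part "n2_bracket s" dot
  for s :: n2_sector and dot :: "(n2_basis \<Rightarrow>\<^sub>0 complex) \<Rightarrow> (n2_basis \<Rightarrow>\<^sub>0 complex) \<Rightarrow> (n2_basis \<Rightarrow>\<^sub>0 complex)"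
begin

abbreviation T :: "(n2_basis \<Rightarrow>\<^sub>0 complex) \<Rightarrow> (n2_basis \<Rightarrow>\<^sub>0 complex)" where
  "T \<equiv> n2_bracket s (gen (J 0))"

lemma module_hom_dot: "module_hom pm_scale pm_scale (dot x)" "module_hom pm_scale pm_scale (\<lambda>x. dot x y)"
  using dot.linear_right dot.linear_left by (simp_all add: linear_iff_module_hom)

lemmas dot_zero_right [simp] = module_hom.zero[OF module_hom_dot(1)]
lemmas dot_add_right = module_hom.add[OF module_hom_dot(1)]
lemmas dot_add_left = module_hom.add[OF module_hom_dot(2)]

lemma dot_odd_even: "z \<in> n2_part 1 \<Longrightarrow> x \<in> n2_part 0 \<Longrightarrow> dot z x \<in> n2_part 1"
  using dot.mult_part[of z 1 x 0] by simp

lemma dot_odd_odd: "z \<in> n2_part 1 \<Longrightarrow> x \<in> n2_part 1 \<Longrightarrow> dot z x \<in> n2_part 0"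
  using dot.mult_part[of z 1 x 1] by simp

lemma leibniz_J:
  assumes "z \<in> n2_part 1" "y \<in> n2_part q"
  shows "pm_scale 2 (dot z (n2_bracket s (gen (J m)) y)) =
    n2_bracket s (dot z (gen (J m))) y + n2_bracket s (gen (J m)) (dot z y)"
  using transposed_leibniz[of "gen (J m)" 0 y q z 1] assms by (simp add: koszul_sign_def)

text \<open>
  Since \<open>z \<cdot> x\<close> is even, \<open>T\<close> kills it, and only the term with \<open>z \<cdot> J\<^sub>0\<close> survives in the rule for
  \<open>x = [J\<^sub>0, T x]\<close>.
\<close>

lemma odd_dot_odd:
  assumes z: "z \<in> n2_part 1" and x: "x \<in> n2_part 1"
  shows "pm_scale 2 (dot z x) = n2_bracket s (dot z (gen (J 0))) (T x)"
  using leibniz_J[OF z J_bracket_odd_part[OF x], of 0 s 0]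
  by (simp add: J0_bracket_involution[OF x] J0_bracket_even dot_odd_odd[OF z J_bracket_odd_part[OF x]])

lemma odd_dot_J1:
  assumes z: "z \<in> n2_part 1"
  shows "T (dot z (gen (J 1))) = n2_bracket s (gen (J 1)) (dot z (gen (J 0)))"
proof -
  have "n2_bracket s (dot z (gen (J 0))) (gen (J 1)) + T (dot z (gen (J 1))) = 0"
    using leibniz_J[OF z, of "gen (J 1)" 0 0] by (simp add: J0_bracket_even)
  then show ?thesis
    using super_antisym[OF dot_odd_even[OF z, of "gen (J 0)"], of "gen (J 1)" 0]
    by (simp add: koszul_sign_def add_eq_0_iff2)
qed

text \<open>
  Both sides of the rule for \<open>[J\<^sub>1, x]\<close> are expressed through \<open>z \<cdot> J\<^sub>0\<close> and \<open>z \<cdot> J\<^sub>1\<close>; the term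
  \<open>[J\<^sub>1, [u, T x]]\<close> that arises is expanded by the Jacobi identity into \<open>[T v, T x]\<close> and a copy of
  the left-hand side. As this left-hand side occurs with the factor two, one copy of it remains.
\<close>

lemma odd_dot_shift:
  assumes z: "z \<in> n2_part 1" and x: "x \<in> n2_part 1"
  defines "u \<equiv> dot z (gen (J 0))" and "v \<equiv> dot z (gen (J 1))"
  shows "n2_bracket s u (T (n2_bracket s (gen (J 1)) x)) =
    pm_scale 2 (n2_bracket s v x) + n2_bracket s (T v) (T x)"
proof -
  let ?J = "n2_bracket s (gen (J 1))"
  have u: "u \<in> n2_part 1" unfolding u_def by (rule dot_odd_even[OF z]) simp
  have Tx: "T x \<in> n2_part 1" and Jx: "?J x \<in> n2_part 1"
    using x by (simp_all add: J_bracket_odd_part)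
  have comm: "?J (T x) = T (?J x)"
    by (rule odd_eqI) (simp_all add: x J_bracket_odd_part lookup_J_bracket_odd)
  have "pm_scale 2 (n2_bracket s u (T (?J x))) = pm_scale 2 (pm_scale 2 (dot z (?J x)))"
    using odd_dot_odd[OF z Jx] by (simp add: u_def)
  also have "\<dots> = pm_scale 2 (n2_bracket s v x) + ?J (pm_scale 2 (dot z x))"
    using leibniz_J[OF z x, of 1] by (simp add: v_def pm.scale_right_distrib n2_bracket_scale)
  also have "?J (pm_scale 2 (dot z x)) = ?J (n2_bracket s u (T x))"
    using odd_dot_odd[OF z x] by (simp add: u_def)
  also have "\<dots> = n2_bracket s (?J u) (T x) + n2_bracket s u (T (?J x))"
    using super_jacobi[OF _ u Tx, of "gen (J 1)" 0] by (simp add: koszul_sign_def comm)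
  also have "?J u = T v"
    using odd_dot_J1[OF z] by (simp add: u_def v_def)
  finally have "pm_scale 2 (n2_bracket s u (T (?J x))) =
    (pm_scale 2 (n2_bracket s v x) + n2_bracket s (T v) (T x)) + n2_bracket s u (T (?J x))"
    by (simp add: add_ac)
  moreover have "pm_scale 2 w = w + w" for w :: "n2_basis \<Rightarrow>\<^sub>0 complex"
    by (rule poly_mapping_eqI) (simp add: lookup_add)
  ultimately show ?thesis by simp
qed

text \<open>
  Moving one index from \<open>G\<^sub>r\<^sup>\<plusminus>\<close> to \<open>u\<close> changes the factor \<open>\<plusminus> (r - s) / 2\<close> at \<open>J\<close> by one, so the
  difference of the two sides of \<open>odd_dot_shift\<close> has the coefficients of \<open>u\<close> themselves, up to sign,
  as its \<open>J\<close>-coefficients. The element \<open>G\<^sup>+\<close> detects the \<open>G\<^sup>-\<close>-part of \<open>u\<close> and vice versa.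
\<close>

lemma odd_dot_J0:
  assumes z: "z \<in> n2_part 1"
  shows "dot z (gen (J 0)) = 0"
proof -
  define u v where "u = dot z (gen (J 0))" and "v = dot z (gen (J 1))"
  have u: "u \<in> n2_part 1" and v: "v \<in> n2_part 1"
    unfolding u_def v_def by (rule dot_odd_even[OF z]; simp)+
  have Tv_eq: "T v = n2_bracket s (gen (J 1)) u"
    using odd_dot_J1[OF z] by (simp add: u_def v_def)
  have v_shift: "Poly_Mapping.lookup v (Gp (j + 1)) = Poly_Mapping.lookup u (Gp j)"
    "Poly_Mapping.lookup v (Gm (j + 1)) = Poly_Mapping.lookup u (Gm j)" for j
    using arg_cong[OF Tv_eq, of "\<lambda>w. Poly_Mapping.lookup w (Gp (j + 1))"]
      arg_cong[OF Tv_eq, of "\<lambda>w. Poly_Mapping.lookup w (Gm (j + 1))"]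
    by (simp_all add: lookup_J_bracket_odd u v)
  note shift = odd_dot_shift[OF z, folded u_def v_def]
  show ?thesis
    unfolding u_def[symmetric]
  proof (rule odd_eqI[OF u])
    fix j
    define n where "n = j + 1 + twice_shift s"
    have "n2_bracket s u (gen (Gp 1)) =
        pm_scale 2 (n2_bracket s v (gen (Gp 0))) + n2_bracket s (T v) (gen (Gp 0))"
      using shift[of "gen (Gp 0)"] by (simp add: n2_bracket_single)
    moreover have "Poly_Mapping.lookup (n2_bracket s u (gen (Gp 1))) (J n) =
        Poly_Mapping.lookup u (Gm j) * of_int (1 - j) / 2"
      using lookup_odd_bracket_G(1)[OF u, of s 1 j] by (simp add: n_def)
    moreover have "Poly_Mapping.lookup (n2_bracket s v (gen (Gp 0))) (J n) =
        Poly_Mapping.lookup u (Gm j) * of_int (0 - (j + 1)) / 2"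
      using lookup_odd_bracket_G(1)[OF v, of s 0 "j + 1"] by (simp add: n_def v_shift)
    moreover have "Poly_Mapping.lookup (n2_bracket s (T v) (gen (Gp 0))) (J n) =
        - Poly_Mapping.lookup u (Gm j) * of_int (0 - (j + 1)) / 2"
      using lookup_odd_bracket_G(1)[OF J_bracket_odd_part[OF v], of s s 0 0 "j + 1"]
      by (simp add: n_def v v_shift lookup_J_bracket_odd)
    ultimately have "Poly_Mapping.lookup u (Gm j) * of_int (1 - j) / 2 =
        Poly_Mapping.lookup u (Gm j) * of_int (0 - (j + 1)) / 2"
      by (simp add: lookup_add lookup_minus)
    then show "Poly_Mapping.lookup u (Gm j) = Poly_Mapping.lookup 0 (Gm j)"
      by (simp add: field_simps)
    have "n2_bracket s u (gen (Gm 1)) =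
        pm_scale 2 (n2_bracket s v (gen (Gm 0))) - n2_bracket s (T v) (gen (Gm 0))"
      using shift[of "gen (Gm 0)"] n2_bracket_scale(2)[of s _ "- 1" "gen (Gm 0)"]
      by (simp add: n2_bracket_single)
    moreover have "Poly_Mapping.lookup (n2_bracket s u (gen (Gm 1))) (J n) =
        Poly_Mapping.lookup u (Gp j) * of_int (j - 1) / 2"
      using lookup_odd_bracket_G(2)[OF u, of s 1 j] by (simp add: n_def)
    moreover have "Poly_Mapping.lookup (n2_bracket s v (gen (Gm 0))) (J n) =
        Poly_Mapping.lookup u (Gp j) * of_int (j + 1 - 0) / 2"
      using lookup_odd_bracket_G(2)[OF v, of s 0 "j + 1"] by (simp add: n_def v_shift)
    moreover have "Poly_Mapping.lookup (n2_bracket s (T v) (gen (Gm 0))) (J n) =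
        Poly_Mapping.lookup u (Gp j) * of_int (j + 1 - 0) / 2"
      using lookup_odd_bracket_G(2)[OF J_bracket_odd_part[OF v], of s s 0 0 "j + 1"]
      by (simp add: n_def v v_shift lookup_J_bracket_odd)
    ultimately have "Poly_Mapping.lookup u (Gp j) * of_int (j - 1) / 2 =
        Poly_Mapping.lookup u (Gp j) * of_int (j + 1 - 0) / 2"
      by (simp add: lookup_add lookup_minus)
    then show "Poly_Mapping.lookup u (Gp j) = Poly_Mapping.lookup 0 (Gp j)"
      by (simp add: field_simps)
  qed (simp add: pm.subspace_0[OF subspace_n2_part])
qed

text \<open>
  On the even part the rule for \<open>[J\<^sub>0, y] = 0\<close> only gives \<open>T (z \<cdot> y) = 0\<close>, which suffices because
  \<open>z \<cdot> y\<close> is odd and \<open>T\<close> is injective there.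
\<close>

lemma odd_dot:
  assumes z: "z \<in> n2_part 1"
  shows "dot z x = 0"
proof -
  have odd: "dot z y = 0" if y: "y \<in> n2_part 1" for y
    using odd_dot_odd[OF z y] odd_dot_J0[OF z] by simp
  have even: "dot z y = 0" if y: "y \<in> n2_part 0" for y
  proof -
    have "T (dot z y) = 0"
      using leibniz_J[OF z y, of 0] y
      by (simp add: odd_dot_J0[OF z] J0_bracket_even)
    then show ?thesis
      using J0_bracket_involution[OF dot_odd_even[OF z y], of s] by simp
  qed
  show ?thesis
    using n2_parts_span[of x] odd even by (metis add.right_neutral dot_add_right)
qed

lemma even_dot_odd:
  assumes "z \<in> n2_part 0" "y \<in> n2_part 1"
  shows "dot z y = 0"
  using dot_supercomm[OF assms] odd_dot[OF assms(2)] by simp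

lemma even_dot_even:
  assumes z: "z \<in> n2_part 0" and y: "y \<in> n2_part 0"
  shows "dot z y = 0"
proof (rule module_hom.eq_0_on_span[OF module_hom_dot(1)])
  show "y \<in> pm.span {n2_bracket s a b | a b. a \<in> n2_part 1 \<and> b \<in> n2_part 1}"
    using even_part_spanned_by_odd_brackets y by blast
next
  fix w assume "w \<in> {n2_bracket s a b | a b. a \<in> n2_part 1 \<and> b \<in> n2_part 1}"
  then obtain a b where w: "w = n2_bracket s a b" and ab: "a \<in> n2_part 1" "b \<in> n2_part 1"
    by blast
  have "pm_scale 2 (dot z w) = 0"
    using transposed_leibniz[OF ab z] by (simp add: w ab z even_dot_odd)
  then show "dot z w = 0" by simp
qed

lemma dot_eq_zero: "dot x y = 0"
proof -
  obtain x0 x1 where "x = x0 + x1" "x0 \<in> n2_part 0" "x1 \<in> n2_part 1"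
    using n2_parts_span by blast
  moreover obtain y0 y1 where "y = y0 + y1" "y0 \<in> n2_part 0" "y1 \<in> n2_part 1"
    using n2_parts_span by blast
  ultimately show ?thesis
    by (simp add: dot_add_left dot_add_right odd_dot even_dot_odd even_dot_even)
qed

end

theorem corollary33:
  fixes s :: n2_sector
  shows "\<not> (\<exists>dot. transposed_poisson_superalgebra pm_scale n2_part (n2_bracket s) dot \<and>
                 nontrivial_structure (n2_bracket s) dot)"
  unfolding nontrivial_structure_def
  by (blast dest: n2_transposed_poisson.dot_eq_zero[OF n2_transposed_poisson.intro])

end
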